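(* Let $\mathbf{x}_1,\dots,\mathbf{x}_N\in\mathbb{R}^n$ be interpolation points, let $\mathbf{X}\in\mathbb{R}^n$ be an evaluation point, let $p_1,\dots,p_m$ be a basis of the space of real polynomials on $\mathbb{R}^n$ of total degree at most $k$, and let $W(\mathbf{x}_1,\mathbf{X}),\dots,W(\mathbf{x}_N,\mathbf{X})\ge 0$ be weights such that the Gram matrix $\mathcal{G}=\mathcal{A}\mathcal{W}\mathcal{A}^{\top}$ is symmetric positive definite. Suppose that the weights themselves satisfy the polynomial reproducing conditions $$\sum_{i=1}^N p(\mathbf{x}_i)\,W(\mathbf{x}_i,\mathbf{X}) = p(\mathbf{X})\quad\text{for every real polynomial } p \text{ on } \mathbb{R}^n \text{ of total degree at most } k .$$ Then every entry of $\mathcal{L}(\mathbf{X})=\mathcal{A}^{\top}\lambda(\mathbf{X})$ equals $1$.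
   Context: Moving least squares (MLS), Backus–Gilbert formulation. $\mathcal{A}\in\mathbb{R}^{m\times N}$ is the matrix $\mathcal{A}_{ij}=p_i(\mathbf{x}_j)$, $\mathbf{P}=(p_1(\mathbf{X}),\dots,p_m(\mathbf{X}))^{\top}\in\mathbb{R}^m$, and $\mathcal{W}=\mathrm{diag}(W(\mathbf{x}_1,\mathbf{X}),\dots,W(\mathbf{x}_N,\mathbf{X}))$. The Gram matrix is $\mathcal{G}=\mathcal{A}\mathcal{W}\mathcal{A}^{\top}\in\mathbb{R}^{m\times m}$, i.e. $\mathcal{G}_{jk}=\sum_{i=1}^N p_j(\mathbf{x}_i)p_k(\mathbf{x}_i)W(\mathbf{x}_i,\mathbf{X})$; it is assumed positive definite. The Lagrange multiplier vector is $\lambda(\mathbf{X})=\mathcal{G}^{-1}\mathbf{P}\in\mathbb{R}^m$, and $\mathcal{L}(\mathbf{X})=\mathcal{A}^{\top}\lambda(\mathbf{X})\in\mathbb{R}^N$. The MLS generating functions are $\Psi(\mathbf{X})=(\psi_1,\dots,\psi_N)^{\top}=\mathcal{W}\mathcal{A}^{\top}\mathcal{G}^{-1}\mathbf{P}$, so that $\psi_i=W(\mathbf{x}_i,\mathbf{X})\,\mathcal{L}_i(\mathbf{X})$ for each $i$. *)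

theory Defs
  imports "HOL-Analysis.Analysis" "HOL-Library.Function_Algebras"
begin

global_interpretation fun_space: vector_space "\<lambda>(c :: real) (f :: 'a \<Rightarrow> real) x. c * f x"
  by unfold_locales (auto simp: fun_eq_iff algebra_simps)

definition monomial_fun :: "('n::finite \<Rightarrow> nat) \<Rightarrow> real ^ 'n \<Rightarrow> real" where
  "monomial_fun \<alpha> x = (\<Prod>i\<in>UNIV. (x $ i) ^ \<alpha> i)"

text \<open>Real polynomials in several variables are identified with the functions they induce, which
  loses nothing because the reals are infinite.\<close>

definition polys_upto :: "nat \<Rightarrow> (real ^ 'n::finite \<Rightarrow> real) set" where
  "polys_upto k = fun_space.span {monomial_fun \<alpha> |\<alpha>. (\<Sum>i\<in>UNIV. \<alpha> i) \<le> k}"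

definition is_basis_of :: "('m \<Rightarrow> 'a \<Rightarrow> real) \<Rightarrow> ('a \<Rightarrow> real) set \<Rightarrow> bool" where
  "is_basis_of p V \<longleftrightarrow>
     inj p \<and> fun_space.independent (range p) \<and> fun_space.span (range p) = V"

definition sym_pos_def :: "real ^ 'm ^ 'm \<Rightarrow> bool" where
  "sym_pos_def M \<longleftrightarrow> transpose M = M \<and> (\<forall>v. v \<noteq> 0 \<longrightarrow> v \<bullet> (M *v v) > 0)"

definition mls_A :: "('m \<Rightarrow> real ^ 'n \<Rightarrow> real) \<Rightarrow> ('N \<Rightarrow> real ^ 'n) \<Rightarrow> real ^ 'N ^ 'm" where
  "mls_A p xs = (\<chi> i j. p i (xs j))"

definition mls_P :: "('m \<Rightarrow> real ^ 'n \<Rightarrow> real) \<Rightarrow> real ^ 'n \<Rightarrow> real ^ 'm" where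
  "mls_P p X = (\<chi> i. p i X)"

definition mls_W ::
  "(real ^ 'n \<Rightarrow> real ^ 'n \<Rightarrow> real) \<Rightarrow> ('N \<Rightarrow> real ^ 'n) \<Rightarrow> real ^ 'n \<Rightarrow> real ^ 'N ^ 'N" where
  "mls_W W xs X = (\<chi> i j. if i = j then W (xs i) X else 0)"

definition mls_gram ::
  "('m \<Rightarrow> real ^ 'n \<Rightarrow> real) \<Rightarrow> (real ^ 'n \<Rightarrow> real ^ 'n \<Rightarrow> real) \<Rightarrow> ('N::finite \<Rightarrow> real ^ 'n) \<Rightarrow>
     real ^ 'n \<Rightarrow> real ^ 'm ^ 'm" where
  "mls_gram p W xs X = mls_A p xs ** mls_W W xs X ** transpose (mls_A p xs)"

definition mls_lambda ::
  "('m::finite \<Rightarrow> real ^ 'n \<Rightarrow> real) \<Rightarrow> (real ^ 'n \<Rightarrow> real ^ 'n \<Rightarrow> real) \<Rightarrow>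
     ('N::finite \<Rightarrow> real ^ 'n) \<Rightarrow> real ^ 'n \<Rightarrow> real ^ 'm" where
  "mls_lambda p W xs X = matrix_inv (mls_gram p W xs X) *v mls_P p X"

definition mls_L ::
  "('m::finite \<Rightarrow> real ^ 'n \<Rightarrow> real) \<Rightarrow> (real ^ 'n \<Rightarrow> real ^ 'n \<Rightarrow> real) \<Rightarrow>
     ('N::finite \<Rightarrow> real ^ 'n) \<Rightarrow> real ^ 'n \<Rightarrow> real ^ 'N" where
  "mls_L p W xs X = transpose (mls_A p xs) *v mls_lambda p W xs X"

end

theory Submission
  imports Defs
begin

text \<open>The constant polynomial 1 has a coefficient vector \<open>c\<close> in the basis \<open>p\<close>, so that
  \<open>A\<^sup>T c\<close> is the all-ones vector. The reproducing condition on the basis says that \<open>A W\<close> sends the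
  all-ones vector to \<open>P\<close>. Hence \<open>G c = A W A\<^sup>T c = P\<close>, so \<open>c\<close> is the Lagrange multiplier vector.\<close>

lemma fun_span_range_finite:
  fixes p :: "'m::finite \<Rightarrow> 'a \<Rightarrow> real"
  assumes "q \<in> fun_space.span (range p)"
  obtains c :: "real ^ 'm" where "\<And>x. q x = (\<Sum>i\<in>UNIV. c $ i * p i x)"
proof -
  have "\<exists>c :: real ^ 'm. \<forall>x. q x = (\<Sum>i\<in>UNIV. c $ i * p i x)"
    using assms
  proof (induction rule: fun_space.span_induct_alt)
    case base
    show ?case by (rule exI[of _ 0]) simp
  next
    case (step a f g)
    then obtain j c where f: "f = p j" and g: "\<forall>x. g x = (\<Sum>i\<in>UNIV. c $ i * p i x)"
      by blast
    \<comment> \<open>Adding \<open>a * p j\<close> changes only the coefficient at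
      \<open>j\<close>, hence the witness \<open>axis j a + c\<close>.\<close>
    have "a * f x + g x = (\<Sum>i\<in>UNIV. (axis j a + c) $ i * p i x)" for x
      by (simp add: f g axis_def distrib_right sum.distrib if_distrib[of "\<lambda>t. t * _"] cong: if_cong)
    then show ?case by (intro exI[of _ "axis j a + c"]) simp
  qed
  then show ?thesis using that by blast
qed

lemma one_in_polys_upto: "(\<lambda>x. 1) \<in> polys_upto k"
proof -
  have "(\<lambda>x. 1) = monomial_fun (\<lambda>i. 0)"
    by (simp add: monomial_fun_def fun_eq_iff)
  then show ?thesis
    unfolding polys_upto_def by (intro fun_space.span_base) auto
qed

text \<open>A nonzero kernel vector would make the quadratic form vanish; for a square matrix, a
  trivial kernel suffices.\<close>

lemma sym_pos_def_invertible:
  fixes M :: "real ^ 'm ^ 'm"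
  assumes "sym_pos_def M"
  shows "invertible M"
proof -
  have "x = 0" if "M *v x = 0" for x
    using assms that unfolding sym_pos_def_def by fastforce
  then show ?thesis
    by (simp add: invertible_left_inverse matrix_left_invertible_ker)
qed

text \<open>Avoids computing the inverse: to identify the multiplier it is enough to exhibit one
  solution of \<open>G c = P\<close>.\<close>

lemma mls_lambda_unique:
  fixes p :: "'m::finite \<Rightarrow> real ^ 'n \<Rightarrow> real"
    and xs :: "'N::finite \<Rightarrow> real ^ 'n"
  assumes "sym_pos_def (mls_gram p W xs X)" and "mls_gram p W xs X *v c = mls_P p X"
  shows "mls_lambda p W xs X = c"
proof -
  \<comment> \<open>\<open>matrix_inv\<close> is a Hilbert choice, so its defining property rests on
    invertibility.\<close>
  have "matrix_inv (mls_gram p W xs X) ** mls_gram p W xs X = mat 1"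
    using someI_ex[OF sym_pos_def_invertible[OF assms(1), unfolded invertible_def]]
    by (simp add: matrix_inv_def)
  then show ?thesis
    unfolding mls_lambda_def assms(2)[symmetric] by (simp add: matrix_vector_mul_assoc)
qed

theorem lemma1:
  fixes xs :: "'N::finite \<Rightarrow> real ^ 'n::finite"
    and X :: "real ^ 'n"
    and p :: "'m::finite \<Rightarrow> real ^ 'n \<Rightarrow> real"
    and W :: "real ^ 'n \<Rightarrow> real ^ 'n \<Rightarrow> real"
    and k :: nat
  assumes basis: "is_basis_of p (polys_upto k)"
    and weights_nonneg: "\<And>i. W (xs i) X \<ge> 0"
    and gram: "sym_pos_def (mls_gram p W xs X)"
    and reproducing: "\<And>q. q \<in> polys_upto k \<Longrightarrow> (\<Sum>i\<in>UNIV. q (xs i) * W (xs i) X) = q X"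
  shows "\<forall>i. mls_L p W xs X $ i = 1"
proof -
  have span: "fun_space.span (range p) = polys_upto k"
    using basis by (simp add: is_basis_of_def)
  obtain c :: "real ^ 'm" where c: "\<And>x. 1 = (\<Sum>i\<in>UNIV. c $ i * p i x)"
    using one_in_polys_upto[of k] fun_span_range_finite[of "\<lambda>x. 1" p] span by metis
  have At_c: "transpose (mls_A p xs) *v c = 1"
    by (simp add: vec_eq_iff matrix_vector_mult_def transpose_def mls_A_def c[symmetric] mult.commute)
  have W_one: "mls_W W xs X *v 1 = (\<chi> i. W (xs i) X)"
    by (simp add: vec_eq_iff matrix_vector_mult_def mls_W_def)
  have p_mem: "p i \<in> polys_upto k" for i
    using fun_space.span_base[of "p i" "range p"] by (simp add: span)
  have "mls_A p xs *v (\<chi> i. W (xs i) X) = mls_P p X"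
    by (simp add: vec_eq_iff matrix_vector_mult_def mls_A_def mls_P_def reproducing[OF p_mem])
  \<comment> \<open>The product is evaluated from the right: \<open>c\<close> goes to the all-ones
    vector, then to the weights, then to \<open>P\<close>. The deleted simp rule would turn
    \<open>transpose A *v c\<close> into \<open>c v* A\<close> and hide it from
    \<open>At_c\<close>.\<close>
  then have "mls_gram p W xs X *v c = mls_P p X"
    by (simp add: mls_gram_def At_c W_one del: transpose_matrix_vector flip: matrix_vector_mul_assoc)
  then show ?thesis
    by (simp add: mls_L_def mls_lambda_unique[OF gram] At_c del: transpose_matrix_vector)
qed

end
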